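(* Let $T$ be an oscillatory tetradiagonal Hessenberg matrix and let $\mathcal K[1]$ be its associated infinite continued fraction. Then for each real $\alpha_2<\mathcal K[1]$ there exists a unique positive sequence $\{\alpha_1,\alpha_3,\alpha_4,\alpha_5,\dots\}$ (all indices $j\in\mathbb N$, $j\neq 2$) such that $T=L_1L_2U$, where $L_1$ is lower unitriangular bidiagonal with first subdiagonal $(\alpha_2,\alpha_5,\alpha_8,\dots)$, $L_2$ is lower unitriangular bidiagonal with first subdiagonal $(\alpha_3,\alpha_6,\alpha_9,\dots)$, and $U$ is upper bidiagonal with diagonal $(\alpha_1,\alpha_4,\alpha_7,\dots)$ and all entries of the first superdiagonal equal to $1$. If $\alpha_2\in[0,\mathcal K[1])$, then $L_1,L_2,U\in\operatorname{InTN}$. Moreover, with $\alpha_0=\alpha_{-1}=0$, the entries of $T$ satisfy $$c_n=\alpha_{3n+1}+\alpha_{3n}+\alpha_{3n-1}\ (n\ge 0),\qquad b_n=\alpha_{3n}\alpha_{3n-2}+\alpha_{3n-1}\alpha_{3n-2}+\alpha_{3n-1}\alpha_{3n-3}\ (n\ge1),\qquad a_n=\alpha_{3n-1}\alpha_{3n-3}\alpha_{3n-5}\ (n\ge2).$$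
   Context: A tetradiagonal Hessenberg matrix is a real semi-infinite matrix $T=(T_{i,j})_{i,j\ge0}$ with $T_{n,n+1}=1$, $T_{n,n}=c_n$ ($n\ge0$), $T_{n,n-1}=b_n$ ($n\ge1$), $T_{n,n-2}=a_n$ ($n\ge2$), all other entries $0$, and $a_n>0$ for all $n\ge2$. $T^{[N]}$ is the leading principal submatrix with rows and columns $0,\dots,N$. A finite matrix is TN if all its minors are nonnegative, InTN if it is TN and nonsingular, and oscillatory if it is TN and some power of it has all minors positive (equivalently, TN, irreducible and nonsingular). A semi-infinite matrix is called oscillatory (resp. InTN) if all its leading principal submatrices are. For $T$ oscillatory let $\delta^{[n]}=\det T^{[n]}>0$, $\delta^{[-1]}=1$. The Gauss--Borel factorization is the unique factorization $T=LU$ with $U$ upper bidiagonal with first superdiagonal of ones and diagonal $(\alpha_1,\alpha_4,\alpha_7,\dots)$, and $L$ lower unitriangular with $L_{n,n-1}=m_n$ ($n\ge1$), $L_{n,n-2}=l_n$ ($n\ge2$), other subdiagonal entries zero; explicitly $\alpha_{3n+1}=\delta^{[n]}/\delta^{[n-1]}$, $m_n=c_n-\alpha_{3n+1}$, $l_n=a_n/\alpha_{3n-5}$. For $n\ge k\ge1$ let $$\mathcal K[n,k]=m_k-\cfrac{l_{k+1}}{m_{k+1}-\cfrac{l_{k+2}}{\ddots-\cfrac{l_n}{m_n}}},\qquad \mathcal K[k,k]=m_k.$$ The infinite continued fraction associated with $T$ is $\mathcal K[1]=\lim_{n\to\infty}\mathcal K[n,1]$ (this limit exists and is nonnegative). 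*)

theory Defs
  imports
    Complex_Main
    "HOL-Library.Groups_Big_Fun"
    "Jordan_Normal_Form.Determinant"
    "Jordan_Normal_Form.DL_Submatrix"
begin

definition totally_nonneg :: "real mat \<Rightarrow> bool" where
  "totally_nonneg A \<longleftrightarrow>
     (\<forall>I\<subseteq>{..<dim_row A}. \<forall>J\<subseteq>{..<dim_col A}.
        card I = card J \<longrightarrow> 0 \<le> det (submatrix A I J))"

definition totally_pos :: "real mat \<Rightarrow> bool" where
  "totally_pos A \<longleftrightarrow>
     (\<forall>I\<subseteq>{..<dim_row A}. \<forall>J\<subseteq>{..<dim_col A}.
        card I = card J \<longrightarrow> 0 < det (submatrix A I J))"

definition InTN_mat :: "real mat \<Rightarrow> bool" where
  "InTN_mat A \<longleftrightarrow> square_mat A \<and> totally_nonneg A \<and> det A \<noteq> 0"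

text \<open>The exponent must be positive: the zeroth power of a 1-by-1 matrix is always totally
  positive.\<close>

definition oscillatory_mat :: "real mat \<Rightarrow> bool" where
  "oscillatory_mat A \<longleftrightarrow>
     square_mat A \<and> totally_nonneg A \<and> (\<exists>k\<ge>1. totally_pos (A ^\<^sub>m k))"

text \<open>Semi-infinite matrices are functions of the row and column index, both starting at 0.\<close>

type_synonym smat = "nat \<Rightarrow> nat \<Rightarrow> real"

text \<open>The leading principal submatrix with rows and columns \<open>0, \<dots>, N\<close>, of size \<open>N + 1\<close>.\<close>

definition leading :: "smat \<Rightarrow> nat \<Rightarrow> real mat" where
  "leading T N = mat (Suc N) (Suc N) (\<lambda>(i, j). T i j)"

definition InTN :: "smat \<Rightarrow> bool" where
  "InTN T \<longleftrightarrow> (\<forall>N. InTN_mat (leading T N))"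

definition oscillatory :: "smat \<Rightarrow> bool" where
  "oscillatory T \<longleftrightarrow> (\<forall>N. oscillatory_mat (leading T N))"

text \<open>\<open>Sum_any\<close> sums over the finite support of its argument; the supports are finite whenever
  the rows of the left factor are finitely supported, as for all banded matrices below.\<close>

definition smat_mult :: "smat \<Rightarrow> smat \<Rightarrow> smat" (infixl "**\<^sub>s" 70) where
  "A **\<^sub>s B = (\<lambda>i j. Sum_any (\<lambda>k. A i k * B k j))"

text \<open>The values \<open>b 0\<close>, \<open>a 0\<close> and \<open>a 1\<close> do not occur in the matrix.\<close>

definition tetradiagonal_Hessenberg ::
    "smat \<Rightarrow> (nat \<Rightarrow> real) \<Rightarrow> (nat \<Rightarrow> real) \<Rightarrow> (nat \<Rightarrow> real) \<Rightarrow> bool" where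
  "tetradiagonal_Hessenberg T c b a \<longleftrightarrow>
     (\<forall>i j. T i j = (if j = i + 1 then 1
                     else if j = i then c i
                     else if i = j + 1 then b i
                     else if i = j + 2 then a i
                     else 0)) \<and>
     (\<forall>n\<ge>2. a n > 0)"

definition lower_unit_bidiag :: "(nat \<Rightarrow> real) \<Rightarrow> smat" where
  "lower_unit_bidiag s = (\<lambda>i j. if i = j then 1 else if i = j + 1 then s j else 0)"

definition upper_bidiag :: "(nat \<Rightarrow> real) \<Rightarrow> smat" where
  "upper_bidiag d = (\<lambda>i j. if i = j then d i else if j = i + 1 then 1 else 0)"

text \<open>The entries of the Gauss--Borel factorization \<open>T = L U\<close>: \<open>GB_diag T n\<close> is the diagonal
  entry \<open>\<alpha>\<^bsub>3n+1\<^esub>\<close> of \<open>U\<close> in row \<open>n\<close>, while \<open>GB_m T n\<close> (for \<open>n \<ge> 1\<close>) and \<open>GB_l T n\<close>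
  (for \<open>n \<ge> 2\<close>) are the entries of \<open>L\<close> at \<open>(n, n - 1)\<close> and \<open>(n, n - 2)\<close>. The diagonal index
  \<open>3n - 5\<close> is \<open>3(n - 2) + 1\<close>.\<close>

definition GB_diag :: "smat \<Rightarrow> nat \<Rightarrow> real" where
  "GB_diag T n = det (leading T n) / (if n = 0 then 1 else det (leading T (n - 1)))"

definition GB_m :: "smat \<Rightarrow> nat \<Rightarrow> real" where
  "GB_m T n = T n n - GB_diag T n"

definition GB_l :: "smat \<Rightarrow> nat \<Rightarrow> real" where
  "GB_l T n = T n (n - 2) / GB_diag T (n - 2)"

text \<open>\<open>cont_frac m l k d\<close> starts at \<open>m k\<close> and ends at \<open>m (k + d)\<close>.\<close>

fun cont_frac :: "(nat \<Rightarrow> real) \<Rightarrow> (nat \<Rightarrow> real) \<Rightarrow> nat \<Rightarrow> nat \<Rightarrow> real" where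
  "cont_frac m l k 0 = m k"
| "cont_frac m l k (Suc d) = m k - l (Suc k) / cont_frac m l (Suc k) d"

definition K_fin :: "smat \<Rightarrow> nat \<Rightarrow> nat \<Rightarrow> real" where
  "K_fin T n k = cont_frac (GB_m T) (GB_l T) k (n - k)"

definition K_inf :: "smat \<Rightarrow> real" where
  "K_inf T = lim (\<lambda>n. K_fin T n 1)"

text \<open>The three bidiagonal factors determined by a sequence \<open>\<alpha>\<close>. Integer indices allow for
  \<open>\<alpha> 0\<close> and \<open>\<alpha> (-1)\<close>.\<close>

definition L1_of :: "(int \<Rightarrow> real) \<Rightarrow> smat" where
  "L1_of \<alpha> = lower_unit_bidiag (\<lambda>j. \<alpha> (3 * int j + 2))"

definition L2_of :: "(int \<Rightarrow> real) \<Rightarrow> smat" where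
  "L2_of \<alpha> = lower_unit_bidiag (\<lambda>j. \<alpha> (3 * int j + 3))"

definition U_of :: "(int \<Rightarrow> real) \<Rightarrow> smat" where
  "U_of \<alpha> = upper_bidiag (\<lambda>j. \<alpha> (3 * int j + 1))"

text \<open>A sequence indexed by the positive integers is encoded as a function on the integers that
  vanishes at all other indices, so that uniqueness of the sequence is uniqueness of the function.
  The entry at index 2 is prescribed and may have any sign.\<close>

definition positive_bidiagonal_factorization :: "smat \<Rightarrow> real \<Rightarrow> (int \<Rightarrow> real) \<Rightarrow> bool" where
  "positive_bidiagonal_factorization T x \<alpha> \<longleftrightarrow>
     (\<forall>j\<le>0. \<alpha> j = 0) \<and> \<alpha> 2 = x \<and> (\<forall>j\<ge>1. j \<noteq> 2 \<longrightarrow> \<alpha> j > 0) \<and>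
     T = L1_of \<alpha> **\<^sub>s L2_of \<alpha> **\<^sub>s U_of \<alpha>"

end

theory Submission
  imports Defs
begin

text \<open>Splitting the lower factor \<open>L\<close> of \<open>T = L U\<close> into \<open>L\<^sub>1 L\<^sub>2\<close>, with subdiagonals \<open>s\<close> and \<open>t\<close>, means
  solving \<open>m (n + 1) = s n + t n\<close> and \<open>l (n + 2) = s (n + 1) * t n\<close> from \<open>s 0 = \<alpha>\<^sub>2\<close>. The finite
  continued fractions \<open>K[n, k]\<close> are ratios of minors of \<open>T\<close>, hence positive for \<open>k \<ge> 2\<close>, and they
  decrease in \<open>n\<close>; so \<open>\<alpha>\<^sub>2 < K[n, 1]\<close> for all \<open>n\<close>, and the bound \<open>s (k - 1) < K[n, k]\<close> propagates from
  \<open>k\<close> to \<open>k + 1\<close>. At \<open>n = k\<close> it reads \<open>t (k - 1) > 0\<close>. Uniqueness holds because, by positivity, the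
  equations for the entries of \<open>T\<close> can be solved for the \<open>\<alpha>\<^sub>j\<close> one after the other.\<close>

text \<open>Cuts a full row or column sum down to the band of \<open>T\<close>. The set
  \<open>S\<close> may reach past \<open>n\<close> as long as \<open>f\<close> vanishes
  there.\<close>

lemma sum_over_support:
  fixes f :: "nat \<Rightarrow> real"
  assumes "finite S" and "\<And>k. k \<le> n \<Longrightarrow> k \<notin> S \<Longrightarrow> f k = 0" and "\<And>k. k \<in> S \<Longrightarrow> n < k \<Longrightarrow> f k = 0"
  shows "sum f {..n} = sum f S"
proof -
  have "sum f {..n} = sum f ({..n} \<inter> S)"
    by (rule sum.mono_neutral_right) (use assms in auto)
  also have "\<dots> = sum f S"
  proof (rule sum.mono_neutral_left)
    show "\<forall>k\<in>S - {..n} \<inter> S. f k = 0"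
      using assms(3) by (metis DiffE IntI atMost_iff not_le)
  qed (use assms(1) in auto)
  finally show ?thesis .
qed

section \<open>Minors of leading principal submatrices\<close>

lemma leading_carrier [simp]: "leading T n \<in> carrier_mat (Suc n) (Suc n)"
  by (simp add: leading_def)

lemma leading_dim [simp]: "dim_row (leading T n) = Suc n" "dim_col (leading T n) = Suc n"
  by (simp_all add: leading_def)

lemma leading_index [simp]: "i \<le> n \<Longrightarrow> j \<le> n \<Longrightarrow> leading T n $$ (i, j) = T i j"
  by (simp add: leading_def)

lemma pick_complement_singleton:
  assumes "k \<le> n" "i < n"
  shows "pick ({..n} - {k}) i = insert_index k i"
proof -
  have "{a \<in> {..n} - {k}. a < insert_index k i} = (if i < k then {..<i} else {..i} - {k})"
    using assms by (auto simp: insert_index_def)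
  then have "card {a \<in> {..n} - {k}. a < insert_index k i} = i"
    by (auto simp: card_Diff_singleton_if)
  moreover have "insert_index k i \<in> {..n} - {k}"
    using assms by (auto simp: insert_index_def)
  ultimately show ?thesis
    by (metis pick_card_in_set)
qed

text \<open>Total nonnegativity speaks of \<open>submatrix\<close>, cofactors of
  \<open>mat_delete\<close>; this is the bridge.\<close>

lemma mat_delete_eq_submatrix:
  assumes A: "A \<in> carrier_mat (Suc n) (Suc n)" and k: "k \<le> n" and l: "l \<le> n"
  shows "mat_delete A k l = submatrix A ({..n} - {k}) ({..n} - {l})"
proof -
  have dim: "card {i. i < Suc n \<and> i \<in> {..n} - {q}} = n" if "q \<le> n" for q
  proof -
    have "{i. i < Suc n \<and> i \<in> {..n} - {q}} = {..n} - {q}" by auto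
    then show ?thesis using that by simp
  qed
  show ?thesis
  proof (rule eq_matI)
    fix i j
    assume "i < dim_row (submatrix A ({..n} - {k}) ({..n} - {l}))"
      "j < dim_col (submatrix A ({..n} - {k}) ({..n} - {l}))"
    then have ij: "i < n" "j < n"
      using A dim k l by (auto simp: dim_submatrix simp del: Diff_iff)
    then have "submatrix A ({..n} - {k}) ({..n} - {l}) $$ (i, j)
        = A $$ (pick ({..n} - {k}) i, pick ({..n} - {l}) j)"
      using A dim k l by (intro submatrix_index) (auto simp del: Diff_iff)
    then show "mat_delete A k l $$ (i, j) = submatrix A ({..n} - {k}) ({..n} - {l}) $$ (i, j)"
      using mat_delete_index[OF A, of k l i j] ij k l by (simp add: pick_complement_singleton)
  qed (use A dim k l in \<open>auto simp: dim_submatrix simp del: Diff_iff\<close>)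
qed

lemma submatrix_full:
  assumes "A \<in> carrier_mat n n"
  shows "submatrix A {..<n} {..<n} = A"
proof -
  have "pick {..<n} i = i" if "i < n" for i
  proof -
    have "{a \<in> {..<n}. a < i} = {..<i}" using that by auto
    then show ?thesis using pick_card_in_set[of i "{..<n}"] that by simp
  qed
  moreover have "card {i. i < n \<and> i \<in> {..<n}} = n" by simp
  ultimately show ?thesis
    using assms by (intro eq_matI) (auto simp: dim_submatrix submatrix_index)
qed

lemma totally_nonneg_det:
  assumes "A \<in> carrier_mat n n" and "totally_nonneg A"
  shows "0 \<le> det A"
  using assms submatrix_full[OF assms(1)] unfolding totally_nonneg_def
  by (metis carrier_matD subset_refl)

lemma totally_nonneg_mat_delete:
  assumes A: "A \<in> carrier_mat (Suc n) (Suc n)" and "totally_nonneg A" "k \<le> n" "l \<le> n"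
  shows "0 \<le> det (mat_delete A k l)"
proof -
  have "card ({..n} - {k}) = card ({..n} - {l})"
    using assms by simp
  moreover have "{..n} - {k} \<subseteq> {..<dim_row A}" "{..n} - {l} \<subseteq> {..<dim_col A}"
    using A by auto
  ultimately show ?thesis
    using assms unfolding totally_nonneg_def by (simp add: mat_delete_eq_submatrix)
qed

text \<open>Some positive power has positive determinant and \<open>det A\<close> as a factor of it,
  so \<open>det A\<close> is nonzero; total nonnegativity settles the sign.\<close>

lemma oscillatory_mat_det_pos:
  assumes A: "A \<in> carrier_mat n n" and osc: "oscillatory_mat A"
  shows "0 < det A"
proof -
  from osc obtain k where k: "k \<ge> 1" "totally_pos (A ^\<^sub>m k)" and tn: "totally_nonneg A"
    by (auto simp: oscillatory_mat_def)
  have pow: "A ^\<^sub>m i \<in> carrier_mat n n" for i using A by simp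
  have "0 < det (A ^\<^sub>m k)"
    using k(2) submatrix_full[OF pow[of k]] pow[of k] unfolding totally_pos_def
    by (metis carrier_matD subset_refl)
  moreover obtain k' where "k = Suc k'" using k by (cases k) auto
  ultimately have "det A \<noteq> 0"
    using det_mult[OF pow A, of k'] by auto
  then show ?thesis using totally_nonneg_det[OF A tn] by simp
qed

lemma det_lower_unitriangular:
  assumes A: "A \<in> carrier_mat n n" and "\<And>i j. i < j \<Longrightarrow> j < n \<Longrightarrow> A $$ (i, j) = 0"
    and "\<And>i. i < n \<Longrightarrow> A $$ (i, i) = 1"
  shows "det A = 1"
proof -
  have "diag_mat A = replicate n 1"
    using assms by (intro nth_equalityI) (auto simp: diag_mat_def)
  then show ?thesis
    using det_lower_triangular[OF assms(2) A] by simp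
qed

section \<open>Total nonnegativity of bidiagonal matrices\<close>

text \<open>The vanishing hypothesis says that in every minor the last row or the last column is zero
  off the corner, so that minors factor into products of entries.\<close>

lemma det_staircase_nonneg:
  fixes A :: smat
  assumes nonneg: "\<And>i j. 0 \<le> A i j"
    and stair: "\<And>i j. (\<forall>i'<i. A i' j = 0) \<or> (\<forall>j'<j. A i j' = 0)"
    and "\<And>i i'. i < i' \<Longrightarrow> i' < n \<Longrightarrow> r i < r i'"
    and "\<And>j j'. j < j' \<Longrightarrow> j' < n \<Longrightarrow> q j < q j'"
  shows "0 \<le> det (mat n n (\<lambda>(i, j). A (r i) (q j)))"
  using assms(3,4)
proof (induction n)
  case 0
  then show ?case by simp
next
  case (Suc n)
  let ?M = "mat (Suc n) (Suc n) (\<lambda>(i, j). A (r i) (q j))"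
  have M: "?M \<in> carrier_mat (Suc n) (Suc n)" by simp
  have del: "mat_delete ?M n n = mat n n (\<lambda>(i, j). A (r i) (q j))"
    by (rule eq_matI) (auto simp: mat_delete_def)
  have cof: "cofactor ?M n n = det (mat n n (\<lambda>(i, j). A (r i) (q j)))"
    unfolding cofactor_def del by simp
  \<comment> \<open>Since \<open>r\<close> and \<open>q\<close> increase, all other entries of the
    last column, or of the last row, lie in the zero region, and Laplace expansion keeps only the
    corner.\<close>
  have "det ?M = A (r n) (q n) * cofactor ?M n n"
    using stair[of "r n" "q n"]
  proof
    assume *: "\<forall>i'<r n. A i' (q n) = 0"
    have "(\<Sum>i<n. ?M $$ (i, n) * cofactor ?M i n) = 0"
      using * Suc.prems(1) by (intro sum.neutral) auto
    then show ?thesis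
      using laplace_expansion_column[OF M, of n] by simp
  next
    assume *: "\<forall>j'<q n. A (r n) j' = 0"
    have "(\<Sum>j<n. ?M $$ (n, j) * cofactor ?M n j) = 0"
      using * Suc.prems(2) by (intro sum.neutral) auto
    then show ?thesis
      using laplace_expansion_row[OF M, of n] by simp
  qed
  moreover have "0 \<le> det (mat n n (\<lambda>(i, j). A (r i) (q j)))"
    by (rule Suc.IH) (use Suc.prems in auto)
  ultimately show ?case
    using nonneg by (simp add: cof)
qed

lemma totally_nonneg_leading_staircase:
  fixes A :: smat
  assumes "\<And>i j. 0 \<le> A i j" "\<And>i j. (\<forall>i'<i. A i' j = 0) \<or> (\<forall>j'<j. A i j' = 0)"
  shows "totally_nonneg (leading A N)"
  unfolding totally_nonneg_def
proof (intro allI impI)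
  fix I J
  assume "I \<subseteq> {..<dim_row (leading A N)}" "J \<subseteq> {..<dim_col (leading A N)}" "card I = card J"
  then have IJ: "I \<subseteq> {..N}" "J \<subseteq> {..N}" "card I = card J"
    using leading_carrier[of A N] by (auto simp: less_Suc_eq_le)
  have pick_le: "pick S i \<le> N" if "S \<subseteq> {..N}" "i < card S" for S i
    using pick_in_set_le[OF that(2)] that(1) by auto
  have "{i. i < Suc N \<and> i \<in> I} = I" "{i. i < Suc N \<and> i \<in> J} = J"
    using IJ by auto
  then have "submatrix (leading A N) I J
      = mat (card I) (card I) (\<lambda>(i, j). A (pick I i) (pick J j))"
    using IJ leading_carrier[of A N]
    by (intro eq_matI) (auto simp: dim_submatrix submatrix_index pick_le)
  moreover have "0 \<le> det (mat (card I) (card I) (\<lambda>(i, j). A (pick I i) (pick J j)))"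
    by (rule det_staircase_nonneg) (use assms IJ pick_mono_le in auto)
  ultimately show "0 \<le> det (submatrix (leading A N) I J)" by simp
qed

lemma InTN_lower_unit_bidiag:
  assumes "\<And>j. 0 \<le> s j"
  shows "InTN (lower_unit_bidiag s)"
  unfolding InTN_def InTN_mat_def
proof (intro allI conjI)
  fix N
  show "totally_nonneg (leading (lower_unit_bidiag s) N)"
    by (rule totally_nonneg_leading_staircase) (use assms in \<open>auto simp: lower_unit_bidiag_def\<close>)
  have "det (leading (lower_unit_bidiag s) N) = 1"
    by (rule det_lower_unitriangular[of _ "Suc N"]) (auto simp: lower_unit_bidiag_def leading_def)
  then show "det (leading (lower_unit_bidiag s) N) \<noteq> 0" by simp
qed (simp add: leading_def)

lemma InTN_upper_bidiag:
  assumes "\<And>j. 0 < d j"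
  shows "InTN (upper_bidiag d)"
  unfolding InTN_def InTN_mat_def
proof (intro allI conjI)
  fix N
  have "0 \<le> d j" for j using assms[of j] by simp
  then show "totally_nonneg (leading (upper_bidiag d) N)"
    by (intro totally_nonneg_leading_staircase) (auto simp: upper_bidiag_def)
  have nz: "d j \<noteq> 0" for j using assms[of j] by simp
  have "det (leading (upper_bidiag d) N) = prod_list (diag_mat (leading (upper_bidiag d) N))"
    by (rule det_upper_triangular[of _ "Suc N"])
      (auto simp: upper_bidiag_def leading_def upper_triangular_def)
  then show "det (leading (upper_bidiag d) N) \<noteq> 0"
    using nz by (auto simp: upper_bidiag_def leading_def diag_mat_def simp del: upt_Suc)
qed (simp add: leading_def)

section \<open>Products of bidiagonal matrices\<close>

lemma lower_unit_bidiag_mult: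
  "(lower_unit_bidiag s **\<^sub>s B) i j = B i j + (if i = 0 then 0 else s (i - 1) * B (i - 1) j)"
proof -
  \<comment> \<open>Row \<open>i\<close> of the left factor vanishes outside
    \<open>{i - 1, i}\<close>; for \<open>i = 0\<close> truncated subtraction makes this
    \<open>{0}\<close>.\<close>
  have "Sum_any (\<lambda>k. lower_unit_bidiag s i k * B k j)
      = sum (\<lambda>k. lower_unit_bidiag s i k * B k j) {i - 1, i}"
    by (rule Sum_any.expand_superset) (auto simp: lower_unit_bidiag_def split: if_splits)
  also have "\<dots> = B i j + (if i = 0 then 0 else s (i - 1) * B (i - 1) j)"
    by (cases i) (auto simp: lower_unit_bidiag_def)
  finally show ?thesis by (simp add: smat_mult_def)
qed

lemma mult_upper_bidiag:
  "(A **\<^sub>s upper_bidiag d) i j = A i j * d j + (if j = 0 then 0 else A i (j - 1))"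
proof -
  have "Sum_any (\<lambda>k. A i k * upper_bidiag d k j)
      = sum (\<lambda>k. A i k * upper_bidiag d k j) {j - 1, j}"
    by (rule Sum_any.expand_superset) (auto simp: upper_bidiag_def split: if_splits)
  also have "\<dots> = A i j * d j + (if j = 0 then 0 else A i (j - 1))"
    by (cases j) (auto simp: upper_bidiag_def)
  finally show ?thesis by (simp add: smat_mult_def)
qed

lemma bidiagonal_product:
  "(lower_unit_bidiag s **\<^sub>s lower_unit_bidiag t **\<^sub>s upper_bidiag d) i j =
     (if j = i + 1 then 1
      else if j = i then d i + (if i = 0 then 0 else s (i - 1) + t (i - 1))
      else if i = j + 1 then (s j + t j) * d j + (if j = 0 then 0 else s j * t (j - 1))
      else if i = j + 2 then s (j + 1) * t j * d j
      else 0)"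
proof -
  have L: "(lower_unit_bidiag s **\<^sub>s lower_unit_bidiag t) i j =
     (if j = i then 1 else if i = j + 1 then s j + t j
      else if i = j + 2 then s (j + 1) * t j else 0)" for i j
    unfolding lower_unit_bidiag_mult by (cases i) (auto simp: lower_unit_bidiag_def)
  show ?thesis
    unfolding mult_upper_bidiag L by (cases i; cases j) (auto simp: algebra_simps)
qed

text \<open>Compares both sides diagonal by diagonal. The zeros of \<alpha> at nonpositive indices
  absorb the boundary terms in \<open>c 0\<close> and \<open>b 1\<close>.\<close>

lemma bidiagonal_factorization_iff:
  assumes T: "tetradiagonal_Hessenberg T c b a" and \<alpha>: "\<forall>j\<le>0. \<alpha> j = 0"
  shows "T = L1_of \<alpha> **\<^sub>s L2_of \<alpha> **\<^sub>s U_of \<alpha> \<longleftrightarrow>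
       (\<forall>n. c n = \<alpha> (3 * int n + 1) + \<alpha> (3 * int n) + \<alpha> (3 * int n - 1)) \<and>
       (\<forall>n\<ge>1. b n = \<alpha> (3 * int n) * \<alpha> (3 * int n - 2)
                     + \<alpha> (3 * int n - 1) * \<alpha> (3 * int n - 2)
                     + \<alpha> (3 * int n - 1) * \<alpha> (3 * int n - 3)) \<and>
       (\<forall>n\<ge>2. a n = \<alpha> (3 * int n - 1) * \<alpha> (3 * int n - 3) * \<alpha> (3 * int n - 5))"
    (is "_ \<longleftrightarrow> (\<forall>n. ?c n) \<and> (\<forall>n\<ge>1. ?b n) \<and> (\<forall>n\<ge>2. ?a n)")
proof -
  let ?P = "L1_of \<alpha> **\<^sub>s L2_of \<alpha> **\<^sub>s U_of \<alpha>"
  note prod = bidiagonal_product[of "\<lambda>j. \<alpha> (3 * int j + 2)" "\<lambda>j. \<alpha> (3 * int j + 3)"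
      "\<lambda>j. \<alpha> (3 * int j + 1)", folded L1_of_def L2_of_def U_of_def]
  have T_eq: "T i j = (if j = i + 1 then 1 else if j = i then c i
      else if i = j + 1 then b i else if i = j + 2 then a i else 0)" for i j
    using T by (auto simp: tetradiagonal_Hessenberg_def)
  have idx: "3 * (1 + int k) = 3 * int k + 3" for k by simp
  have C: "T n n = ?P n n \<longleftrightarrow> ?c n" for n
    unfolding T_eq prod using \<alpha> by (cases n) (auto simp: idx algebra_simps)
  have B: "T (Suc n) n = ?P (Suc n) n \<longleftrightarrow> ?b (Suc n)" for n
    unfolding T_eq prod using \<alpha> by (cases n) (auto simp: idx algebra_simps)
  have A: "T (n + 2) n = ?P (n + 2) n \<longleftrightarrow> ?a (n + 2)" for n
    unfolding T_eq prod by (auto simp: algebra_simps)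
  show ?thesis
  proof
    assume eq: "T = ?P"
    have "?b n" if "n \<ge> 1" for n
      using B[of "n - 1"] eq that by simp
    moreover have "?a n" if "n \<ge> 2" for n
    proof -
      obtain k where "n = k + 2" using \<open>n \<ge> 2\<close> by (metis add.commute le_Suc_ex)
      then show ?thesis using A[of k] eq by simp
    qed
    ultimately show "(\<forall>n. ?c n) \<and> (\<forall>n\<ge>1. ?b n) \<and> (\<forall>n\<ge>2. ?a n)"
      using C eq by simp
  next
    assume *: "(\<forall>n. ?c n) \<and> (\<forall>n\<ge>1. ?b n) \<and> (\<forall>n\<ge>2. ?a n)"
    have "T i j = ?P i j" for i j
    proof -
      consider "i = j" | "i = Suc j" | "i = j + 2" | "i \<noteq> j" "i \<noteq> j + 1" "i \<noteq> j + 2"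
        by fastforce
      then show ?thesis
      proof cases
        case 1 then show ?thesis using C * by simp
      next
        case 2 then show ?thesis using B[of j] * by simp
      next
        case 3 then show ?thesis using A[of j] * by simp
      next
        case 4 then show ?thesis unfolding T_eq prod by simp
      qed
    qed
    then show "T = ?P" by (intro ext)
  qed
qed

section \<open>Continued fractions\<close>

text \<open>Dividing the recurrence by \<open>w (Suc j)\<close> gives the recursion of the continued
  fraction for the ratios; the zero at \<open>Suc n\<close> terminates it.\<close>

lemma cont_frac_eq_ratio:
  fixes w :: "nat \<Rightarrow> real"
  assumes rec: "\<And>j. j < n \<Longrightarrow> w j = m (Suc j) * w (Suc j) - l (Suc (Suc j)) * w (Suc (Suc j))"
    and pos: "\<And>j. 1 \<le> j \<Longrightarrow> j \<le> n \<Longrightarrow> 0 < w j" and "w (Suc n) = 0"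
  shows "j + Suc d = n \<Longrightarrow> cont_frac m l (Suc j) d = w j / w (Suc j)"
proof (induction d arbitrary: j)
  case 0
  then show ?case using rec[of j] pos[of n] assms(3) by auto
next
  case (Suc d)
  have "0 < w (Suc j)" "0 < w (Suc (Suc j))" using pos Suc.prems by auto
  moreover have "cont_frac m l (Suc (Suc j)) d = w (Suc j) / w (Suc (Suc j))"
    using Suc by simp
  moreover have "w j = m (Suc j) * w (Suc j) - l (Suc (Suc j)) * w (Suc (Suc j))"
    using rec[of j] Suc.prems by simp
  ultimately show ?case by (simp add: diff_divide_distrib)
qed

text \<open>If \<open>w i = 0\<close> with \<open>i \<ge> 1\<close>, the recurrence at
  \<open>i - 1\<close> makes the sum of the nonnegative terms \<open>w (i - 1)\<close> and
  \<open>l (Suc i) * w (Suc i)\<close> zero. Hence a zero would spread upwards to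
  \<open>w n\<close>.\<close>

lemma three_term_positive:
  fixes w :: "nat \<Rightarrow> real"
  assumes rec: "\<And>j. j < n \<Longrightarrow> w j = m (Suc j) * w (Suc j) - l (Suc (Suc j)) * w (Suc (Suc j))"
    and nonneg: "\<And>j. j \<le> n \<Longrightarrow> 0 \<le> w j" and "0 < w n"
    and l: "\<And>j. 2 \<le> j \<Longrightarrow> 0 < l j"
    and "1 \<le> j" "j \<le> n"
  shows "0 < w j"
proof (rule ccontr)
  assume "\<not> 0 < w j"
  then have "w j = 0" using nonneg[OF \<open>j \<le> n\<close>] by simp
  moreover have "w i = 0 \<longrightarrow> w (Suc i) = 0" if "j \<le> i" "i < n" for i
  proof
    assume "w i = 0"
    moreover have "Suc (i - 1) = i" using that \<open>1 \<le> j\<close> by simp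
    ultimately have "l (Suc i) * w (Suc i) \<le> 0"
      using rec[of "i - 1"] nonneg[of "i - 1"] that by simp
    then show "w (Suc i) = 0"
      using l[of "Suc i"] nonneg[of "Suc i"] that \<open>1 \<le> j\<close>
      by (simp add: mult_le_0_iff)
  qed
  ultimately have "w n = 0"
    by (intro dec_induct[OF \<open>j \<le> n\<close>, of "\<lambda>i. w i = 0"]) auto
  then show False using \<open>0 < w n\<close> by simp
qed

text \<open>A further level lowers the positive tail starting at \<open>Suc k\<close>, which
  enlarges the subtracted quotient. Only tails starting at 2 or later occur as denominators, so
  \<open>k = 1\<close> is covered.\<close>

lemma cont_frac_antimono:
  assumes pos: "\<And>k d. 2 \<le> k \<Longrightarrow> 0 < cont_frac m l k d" and l: "\<And>k. 2 \<le> k \<Longrightarrow> (0::real) < l k"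
  shows "1 \<le> k \<Longrightarrow> cont_frac m l k (Suc d) \<le> cont_frac m l k d"
proof (induction d arbitrary: k)
  case 0
  have "0 < m (Suc k)" using pos[of "Suc k" 0] 0 by simp
  moreover have "0 < l (Suc k)" using l 0 by simp
  ultimately show ?case by simp
next
  case (Suc d)
  have "l (Suc k) / cont_frac m l (Suc k) d \<le> l (Suc k) / cont_frac m l (Suc k) (Suc d)"
    using Suc.IH[of "Suc k"] pos[of "Suc k"] l[of "Suc k"] Suc.prems
    by (intro divide_left_mono) (auto simp del: cont_frac.simps intro!: mult_pos_pos)
  then show ?case by (subst (1 2) cont_frac.simps) simp
qed

text \<open>The subdiagonal \<open>s\<close> of \<open>L\<^sub>1\<close>, obtained by eliminating
  \<open>t n\<close> from \<open>m (n + 1) = s n + t n\<close> and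
  \<open>l (n + 2) = s (n + 1) * t n\<close>.\<close>

fun bidiag_split :: "(nat \<Rightarrow> real) \<Rightarrow> (nat \<Rightarrow> real) \<Rightarrow> real \<Rightarrow> nat \<Rightarrow> real" where
  "bidiag_split m l x 0 = x"
| "bidiag_split m l x (Suc n) = l (Suc (Suc n)) / (m (Suc n) - bidiag_split m l x n)"

text \<open>With \<open>K\<close> the fraction of depth \<open>d\<close> at \<open>n + 2\<close>,
  the bound at \<open>n\<close> for depth \<open>d + 1\<close> says
  \<open>l (n + 2) / K < m (n + 1) - s n\<close>. Exchanging the two positive denominators gives
  \<open>s (n + 1) < K\<close>.\<close>

lemma bidiag_split_less_cont_frac:
  assumes pos: "\<And>k d. 2 \<le> k \<Longrightarrow> 0 < cont_frac m l k d" and l: "\<And>k. 2 \<le> k \<Longrightarrow> (0::real) < l k"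
    and x: "\<And>d. x < cont_frac m l 1 d"
  shows "bidiag_split m l x n < cont_frac m l (Suc n) d"
proof (induction n arbitrary: d)
  case 0
  then show ?case using x by simp
next
  case (Suc n)
  let ?s = "bidiag_split m l x n" and ?K = "cont_frac m l (Suc (Suc n)) d"
  have "0 < ?K" "0 < l (Suc (Suc n))" using pos l by auto
  moreover have "l (Suc (Suc n)) / ?K < m (Suc n) - ?s"
    using Suc[of "Suc d"] by simp
  moreover from calculation have "0 < m (Suc n) - ?s"
    by (meson divide_pos_pos less_trans)
  ultimately show ?case
    by (simp add: divide_simps mult.commute split: if_splits)
qed

section \<open>The Gauss--Borel factorization\<close>

text \<open>The recurrence for leading principal minors, indexed by size: the value at
  \<open>n\<close> is to be the determinant of order \<open>n\<close>, with 1 for the empty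
  one.\<close>

fun hessenberg_det :: "(nat \<Rightarrow> real) \<Rightarrow> (nat \<Rightarrow> real) \<Rightarrow> (nat \<Rightarrow> real) \<Rightarrow> nat \<Rightarrow> real" where
  "hessenberg_det c b a 0 = 1"
| "hessenberg_det c b a (Suc 0) = c 0"
| "hessenberg_det c b a (Suc (Suc 0)) = c 1 * c 0 - b 1"
| "hessenberg_det c b a (Suc (Suc (Suc n))) =
     c (n + 2) * hessenberg_det c b a (n + 2) - b (n + 2) * hessenberg_det c b a (n + 1)
     + a (n + 2) * hessenberg_det c b a n"

locale regular_hessenberg =
  fixes T :: smat and c b a :: "nat \<Rightarrow> real"
  assumes tetradiagonal: "tetradiagonal_Hessenberg T c b a"
    and totally_nonneg: "totally_nonneg (leading T n)"
    and det_pos: "0 < det (leading T n)"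
begin

lemma T_eq: "T i j = (if j = i + 1 then 1 else if j = i then c i
    else if i = j + 1 then b i else if i = j + 2 then a i else 0)"
  using tetradiagonal by (auto simp: tetradiagonal_Hessenberg_def)

lemma a_pos: "2 \<le> n \<Longrightarrow> 0 < a n"
  using tetradiagonal by (auto simp: tetradiagonal_Hessenberg_def)

abbreviation p :: "nat \<Rightarrow> real" where "p \<equiv> hessenberg_det c b a"
abbreviation d :: "nat \<Rightarrow> real" where "d \<equiv> GB_diag T"
abbreviation m :: "nat \<Rightarrow> real" where "m \<equiv> GB_m T"
abbreviation l :: "nat \<Rightarrow> real" where "l \<equiv> GB_l T"

lemma cofactor_corner: "cofactor (leading T (Suc n)) (Suc n) (Suc n) = det (leading T n)"
proof -
  have "mat_delete (leading T (Suc n)) (Suc n) (Suc n) = leading T n"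
    by (rule eq_matI) (auto simp: mat_delete_def leading_def)
  then show ?thesis by (simp add: cofactor_def)
qed

text \<open>Deleting the last row and first column moves the superdiagonal of ones onto the
  diagonal, with zeros above it.\<close>

lemma cofactor_last_row_first: "cofactor (leading T n) n 0 = (-1) ^ n"
proof -
  have "det (mat_delete (leading T n) n 0) = 1"
    by (rule det_lower_unitriangular[of _ n]) (auto simp: mat_delete_def leading_def T_eq)
  then show ?thesis by (simp add: cofactor_def)
qed

text \<open>Entry \<open>(i, n)\<close> of the product of a matrix with its adjugate, whose last
  column holds the cofactors of the last row.\<close>

lemma row_cofactor_sum:
  assumes "i \<le> n"
  shows "(\<Sum>j\<le>n. T i j * cofactor (leading T n) n j) = (if i = n then det (leading T n) else 0)"
proof -
  have "(leading T n * adj_mat (leading T n)) $$ (i, n)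
      = (\<Sum>j\<le>n. T i j * cofactor (leading T n) n j)"
    using assms by (auto simp: scalar_prod_def adj_mat_def leading_def atLeast0LessThan
        lessThan_Suc_atMost intro!: sum.cong)
  then show ?thesis
    using adj_mat(2)[OF leading_carrier, of T n] assms by auto
qed

lemma col_cofactor_sum:
  assumes "j \<le> n"
  shows "(\<Sum>i\<le>n. cofactor (leading T n) i n * T i j) = (if j = n then det (leading T n) else 0)"
proof -
  have "(adj_mat (leading T n) * leading T n) $$ (n, j)
      = (\<Sum>i\<le>n. cofactor (leading T n) i n * T i j)"
    using assms by (auto simp: scalar_prod_def adj_mat_def leading_def atLeast0LessThan
        lessThan_Suc_atMost intro!: sum.cong)
  then show ?thesis
    using adj_mat(3)[OF leading_carrier, of T n] assms by auto
qed

text \<open>The last-row cofactors \<open>u\<close> of order \<open>n + 2\<close> annihilate all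
  earlier rows. As row \<open>i\<close> has a 1 in column \<open>i + 1\<close>, these relations
  determine \<open>u\<close> from \<open>u 0\<close>, giving \<open>p\<close> up to alternating
  signs; the last cofactor is the determinant sought.\<close>

lemma det_leading: "det (leading T n) = p (Suc n)"
proof -
  define u where "u j = cofactor (leading T (Suc n)) (Suc n) j" for j
  have row: "(\<Sum>j\<in>S. T i j * u j) = 0"
    if "i \<le> n" "finite S" "\<And>j. j \<notin> S \<Longrightarrow> T i j = 0" "S \<subseteq> {..Suc n}" for i S
  proof -
    have "(\<Sum>j\<le>Suc n. T i j * u j) = (\<Sum>j\<in>S. T i j * u j)"
      by (rule sum_over_support) (use that in auto)
    then show ?thesis using row_cofactor_sum[of i "Suc n"] that by (simp add: u_def)
  qed
  have u0: "u 0 = (-1) ^ Suc n"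
    unfolding u_def by (rule cofactor_last_row_first)
  have u1: "u 1 = - c 0 * u 0"
    using row[of 0 "{0, 1}"] by (auto simp: T_eq)
  have u2: "u 2 = - c 1 * u 1 - b 1 * u 0" if "1 \<le> n"
    using row[of 1 "{0, 1, 2}"] that by (auto simp: T_eq)
  have u3: "u (i + 3) = - c (i + 2) * u (i + 2) - b (i + 2) * u (i + 1) - a (i + 2) * u i"
    if "i + 2 \<le> n" for i
    using row[of "i + 2" "{i, i + 1, i + 2, i + 3}"] that by (auto simp: T_eq)
  have "u j = (-1) ^ (Suc n + j) * p j" if "j \<le> Suc n" for j
    using that
  proof (induction j rule: less_induct)
    case (less j)
    have "j = 0 \<or> j = 1 \<or> j = 2 \<or> (\<exists>i. j = i + 3)" by presburger
    then consider "j = 0" | "j = 1" | "j = 2" | i where "j = i + 3" by blast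
    then show ?case
    proof cases
      case 1
      then show ?thesis using u0 by simp
    next
      case 2
      then show ?thesis using u0 u1 by simp
    next
      case 3
      then show ?thesis using u0 u1 u2 less.prems by (simp add: numeral_2_eq_2 algebra_simps)
    next
      case (4 i)
      then have "u (i + 2) = (-1) ^ (Suc n + (i + 2)) * p (i + 2)"
        "u (i + 1) = (-1) ^ (Suc n + (i + 1)) * p (i + 1)" "u i = (-1) ^ (Suc n + i) * p i"
        using less by auto
      then show ?thesis
        using u3[of i] 4 less.prems by (simp add: numeral_3_eq_3 algebra_simps)
    qed
  qed
  from this[of "Suc n"] show ?thesis
    using cofactor_corner[of n] by (simp add: u_def)
qed

lemma p_pos: "0 < p n"
  using det_pos[of "n - 1"] by (cases n) (auto simp: det_leading)

lemma d_eq: "d n = p (Suc n) / p n"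
  by (cases n) (auto simp: GB_diag_def det_leading)

lemma d_pos: "0 < d n"
  using p_pos by (simp add: d_eq)

lemma c_eq: "c n = m n + d n"
  by (simp add: GB_m_def T_eq)

text \<open>The default value at index 0 lets row 0 of \<open>T = L U\<close> follow the general
  diagonal equation.\<close>

lemma m_0: "m 0 = 0"
  by (simp add: GB_m_def T_eq d_eq)

lemma a_eq: "2 \<le> n \<Longrightarrow> a n = l n * d (n - 2)"
  using d_pos[of "n - 2"] by (simp add: GB_l_def T_eq)

lemma l_pos: "2 \<le> n \<Longrightarrow> 0 < l n"
  using d_pos[of "n - 2"] a_pos[of n] by (simp add: GB_l_def T_eq)

lemma b_1: "b 1 = m 1 * d 0"
  using p_pos[of 1] by (simp add: GB_m_def T_eq d_eq field_simps)

text \<open>Subdiagonal of \<open>T = L U\<close>: after writing \<open>m\<close>, \<open>l\<close>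
  and \<open>d\<close> through ratios of \<open>p\<close>, this is the recurrence for
  \<open>p (n + 3)\<close> divided by \<open>p (n + 1)\<close>.\<close>

lemma b_eq: "b (n + 2) = m (n + 2) * d (n + 1) + l (n + 2)"
proof -
  have "p n \<noteq> 0" "p (Suc n) \<noteq> 0" "p (Suc (Suc n)) \<noteq> 0"
    using p_pos by (metis less_irrefl)+
  then show ?thesis
    by (simp add: GB_m_def GB_l_def T_eq d_eq field_simps)
qed

text \<open>The last row of the adjugate of \<open>T\<^bsup>[n]\<^esup> = L U\<close> annihilates all columns of \<open>L\<close> but the
  last. Its entries are minors up to alternating signs, which gives nonnegative solutions \<open>w\<close> of
  the recurrence whose ratios are the continued fractions.\<close>

lemma cont_frac_pos_aux:
  assumes "j + Suc e = n"
  shows "0 \<le> cont_frac m l (Suc j) e \<and> (1 \<le> j \<longrightarrow> 0 < cont_frac m l (Suc j) e)"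
proof -
  \<comment> \<open>Extension by zero lets band sums overshoot \<open>n\<close> and supplies the
    terminating value at \<open>Suc n\<close>.\<close>
  define v where "v k = (if k \<le> n then cofactor (leading T n) k n else 0)" for k
  have n: "1 \<le> n" using assms by simp
  have col: "(\<Sum>i\<in>S. v i * T i j) = 0" if "j < n" "finite S" "\<And>i. i \<notin> S \<Longrightarrow> T i j = 0" for j S
  proof -
    have "(\<Sum>i\<le>n. v i * T i j) = (\<Sum>i\<in>S. v i * T i j)"
      by (rule sum_over_support) (use that in \<open>auto simp: v_def\<close>)
    then show ?thesis using col_cofactor_sum[of j n] that by (simp add: v_def)
  qed
  \<comment> \<open>The row vector \<open>v L\<close>. Since \<open>r U = v T\<close> vanishes in
    columns before \<open>n\<close> and \<open>U\<close> has nonzero diagonal, forward substitution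
    gives \<open>r = 0\<close> there.\<close>
  define r where "r j = v j + m (Suc j) * v (Suc j) + l (Suc (Suc j)) * v (Suc (Suc j))" for j
  have r: "r j = 0" if "j < n" for j
    using that
  proof (induction j)
    case 0
    have "c 0 * v 0 + b 1 * v 1 + a 2 * v 2 = 0"
      using col[of 0 "{0, 1, 2}"] 0 by (auto simp: T_eq algebra_simps)
    then have "d 0 * r 0 = 0"
      using c_eq[of 0] m_0 b_1 a_eq[of 2] by (simp add: r_def algebra_simps numeral_2_eq_2)
    then show ?case using d_pos[of 0] by simp
  next
    case (Suc j)
    have "v j + c (j + 1) * v (j + 1) + b (j + 2) * v (j + 2) + a (j + 3) * v (j + 3) = 0"
      using col[of "Suc j" "{j, j + 1, j + 2, j + 3}"] Suc.prems
      by (auto simp: T_eq algebra_simps)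
    then have "r j + d (Suc j) * r (Suc j) = 0"
      using c_eq[of "j + 1"] b_eq[of j] a_eq[of "j + 3"]
      by (simp add: r_def algebra_simps numeral_2_eq_2 numeral_3_eq_3)
    then show ?case using Suc d_pos[of "Suc j"] by simp
  qed
  \<comment> \<open>The sign turns cofactors into minors, which are nonnegative, and the minus signs
    of the recurrence into those of the continued fraction.\<close>
  define w where "w k = (-1) ^ (n + k) * v k" for k
  have rec: "w j = m (Suc j) * w (Suc j) - l (Suc (Suc j)) * w (Suc (Suc j))" if "j < n" for j
  proof -
    have "v j = - m (Suc j) * v (Suc j) - l (Suc (Suc j)) * v (Suc (Suc j))"
      using r[OF that] by (simp add: r_def)
    then show ?thesis unfolding w_def by (simp only:) (simp add: algebra_simps)
  qed
  have w_eq: "w k = det (mat_delete (leading T n) k n)" if "k \<le> n" for k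
  proof -
    have "w k = ((-1) ^ (n + k) * (-1) ^ (n + k)) * det (mat_delete (leading T n) k n)"
      using that by (simp add: w_def v_def cofactor_def add.commute)
    also have "(-1::real) ^ (n + k) * (-1) ^ (n + k) = 1"
      by (simp flip: power_add mult_2)
    finally show ?thesis by simp
  qed
  have nonneg: "0 \<le> w k" if "k \<le> n" for k
    using w_eq[OF that] totally_nonneg_mat_delete[OF leading_carrier totally_nonneg that, of n]
    by simp
  have "w n = det (leading T (n - 1))"
    using cofactor_corner[of "n - 1"] n by (simp add: w_def v_def flip: mult_2)
  then have "0 < w n" using det_pos by simp
  have pos: "0 < w k" if "1 \<le> k" "k \<le> n" for k
    using three_term_positive[where w = w and m = m and l = l and n = n, OF rec nonneg] l_pos
      \<open>0 < w n\<close> that by blast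
  have "cont_frac m l (Suc j) e = w j / w (Suc j)"
    by (rule cont_frac_eq_ratio[of n]) (use rec pos assms in \<open>auto simp: w_def v_def\<close>)
  then show ?thesis
    using assms pos[of "Suc j"] pos[of j] nonneg[of j] by auto
qed

lemma cont_frac_pos: "2 \<le> k \<Longrightarrow> 0 < cont_frac m l k e"
  using cont_frac_pos_aux[OF refl, of "k - 1" e] by auto

lemma cont_frac_1_nonneg: "0 \<le> cont_frac m l 1 e"
  using cont_frac_pos_aux[OF refl, of 0 e] by auto

lemma K_inf_le: "K_inf T \<le> cont_frac m l 1 e"
proof -
  have dec: "decseq (\<lambda>e. cont_frac m l 1 e)"
    by (rule decseq_SucI) (rule cont_frac_antimono; simp add: cont_frac_pos l_pos)
  obtain L where L: "(\<lambda>e. cont_frac m l 1 e) \<longlonglongrightarrow> L" "\<And>e. L \<le> cont_frac m l 1 e"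
    using decseq_convergent[OF dec] cont_frac_1_nonneg by blast
  \<comment> \<open>\<open>K_fin T (Suc n) 1\<close> has depth \<open>n\<close>; the term
    \<open>K_fin T 0 1\<close> does not affect the limit.\<close>
  have "(\<lambda>n. K_fin T (Suc n) 1) \<longlonglongrightarrow> L"
    using L(1) by (simp add: K_fin_def)
  then have "(\<lambda>n. K_fin T n 1) \<longlonglongrightarrow> L"
    by (rule LIMSEQ_imp_Suc)
  then show ?thesis using L(2) limI unfolding K_inf_def by blast
qed

section \<open>Existence of the factorization\<close>

lemma factorization_exists:
  assumes "x < K_inf T"
  shows "\<exists>\<alpha>. positive_bidiagonal_factorization T x \<alpha>"
proof -
  define s where "s = bidiag_split m l x"
  define t where "t n = m (Suc n) - s n" for n
  have "x < cont_frac m l 1 e" for e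
    using assms K_inf_le[of e] by simp
  then have less: "s n < cont_frac m l (Suc n) e" for n e
    unfolding s_def by (intro bidiag_split_less_cont_frac) (auto simp: cont_frac_pos l_pos)
  have t_pos: "0 < t n" for n
    using less[of n 0] by (simp add: t_def)
  have s_Suc: "s (Suc n) = l (Suc (Suc n)) / t n" for n
    by (simp add: s_def t_def)
  have s_0: "s 0 = x" by (simp add: s_def)
  \<comment> \<open>Block \<open>n\<close> consists of the indices \<open>3n + 1\<close>,
    \<open>3n + 2\<close>, \<open>3n + 3\<close>, hence the shift by one before dividing; residue 0
    closes the block.\<close>
  define \<alpha> :: "int \<Rightarrow> real" where "\<alpha> j = (if j \<le> 0 then 0 else
     let n = nat ((j - 1) div 3) in if j mod 3 = 1 then d n else if j mod 3 = 2 then s n else t n)" for j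
  have \<alpha>1: "\<alpha> (3 * int n + 1) = d n" and \<alpha>2: "\<alpha> (3 * int n + 2) = s n"
    and \<alpha>3: "\<alpha> (3 * int n + 3) = t n" for n
    by (auto simp: \<alpha>_def Let_def)
  have zero: "\<forall>j\<le>0. \<alpha> j = 0" by (simp add: \<alpha>_def)
  have s_pos: "0 < s n" if "n > 0" for n
    using that s_Suc[of "n - 1"] t_pos[of "n - 1"] l_pos[of "Suc n"] by simp
  have pos: "0 < \<alpha> j" if "j \<ge> 1" "j \<noteq> 2" for j
  proof -
    define n where "n = nat ((j - 1) div 3)"
    have "int n = (j - 1) div 3" using that by (simp add: n_def)
    then have "j = 3 * int n + 1 \<or> j = 3 * int n + 2 \<or> j = 3 * int n + 3" by presburger
    \<comment> \<open>Index 2 is the case \<open>n = 0\<close>, where \<open>s 0 = x\<close> may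
      have any sign.\<close>
    moreover have "n > 0" if "j = 3 * int n + 2" using that \<open>j \<noteq> 2\<close> by simp
    ultimately show ?thesis
      using \<alpha>1[of n] \<alpha>2[of n] \<alpha>3[of n] d_pos[of n] t_pos[of n] s_pos[of n] by metis
  qed
  have C: "c n = \<alpha> (3 * int n + 1) + \<alpha> (3 * int n) + \<alpha> (3 * int n - 1)" for n
  proof (cases n)
    case 0
    then show ?thesis using \<alpha>1[of 0] zero c_eq[of 0] m_0 by simp
  next
    case (Suc k)
    then show ?thesis
      using \<alpha>1[of n] \<alpha>2[of k] \<alpha>3[of k] c_eq[of n] by (simp add: t_def algebra_simps)
  qed
  have B: "b n = \<alpha> (3 * int n) * \<alpha> (3 * int n - 2) + \<alpha> (3 * int n - 1) * \<alpha> (3 * int n - 2)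
      + \<alpha> (3 * int n - 1) * \<alpha> (3 * int n - 3)" if n: "n \<ge> 1" for n
  proof -
    have "n = 1 \<or> (\<exists>k. n = k + 2)" using n by presburger
    then consider "n = 1" | k where "n = k + 2" by blast
    then show ?thesis
    proof cases
      case 1
      have "b 1 = (t 0 + s 0) * d 0" using b_1 by (simp add: t_def)
      then show ?thesis
        using 1 \<alpha>1[of 0] \<alpha>2[of 0] \<alpha>3[of 0] zero by (simp add: algebra_simps)
    next
      case (2 k)
      have "l (k + 2) = s (Suc k) * t k" using s_Suc[of k] t_pos[of k] by simp
      then have "b (k + 2) = (t (Suc k) + s (Suc k)) * d (Suc k) + s (Suc k) * t k"
        using b_eq[of k] by (simp add: t_def[of "Suc k"])
      then show ?thesis
        using 2 \<alpha>1[of "Suc k"] \<alpha>2[of "Suc k"] \<alpha>3[of "Suc k"] \<alpha>3[of k]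
        by (simp add: algebra_simps)
    qed
  qed
  have A: "a n = \<alpha> (3 * int n - 1) * \<alpha> (3 * int n - 3) * \<alpha> (3 * int n - 5)" if n: "n \<ge> 2" for n
  proof -
    obtain k where k: "n = k + 2" using n by (metis add.commute le_Suc_ex)
    have "l (k + 2) = s (Suc k) * t k" using s_Suc[of k] t_pos[of k] by simp
    then show ?thesis
      using k \<alpha>1[of k] \<alpha>2[of "Suc k"] \<alpha>3[of k] a_eq[of n] by (simp add: algebra_simps)
  qed
  have "\<alpha> 2 = x" using \<alpha>2[of 0] s_0 by simp
  moreover have "T = L1_of \<alpha> **\<^sub>s L2_of \<alpha> **\<^sub>s U_of \<alpha>"
    using bidiagonal_factorization_iff[OF tetradiagonal zero] A B C by blast
  ultimately show ?thesis
    using zero pos unfolding positive_bidiagonal_factorization_def by blast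
qed

end

section \<open>Uniqueness of the factorization\<close>

lemma factorization_unique:
  assumes T: "tetradiagonal_Hessenberg T c b a"
    and \<alpha>: "positive_bidiagonal_factorization T x \<alpha>"
    and \<beta>: "positive_bidiagonal_factorization T x \<beta>"
  shows "\<alpha> = \<beta>"
proof -
  have za: "\<forall>j\<le>0. \<alpha> j = 0" and zb: "\<forall>j\<le>0. \<beta> j = 0" and x: "\<alpha> 2 = \<beta> 2"
    and pa: "\<And>j. j \<ge> 1 \<Longrightarrow> j \<noteq> 2 \<Longrightarrow> \<alpha> j > 0"
    and Ta: "T = L1_of \<alpha> **\<^sub>s L2_of \<alpha> **\<^sub>s U_of \<alpha>" and Tb: "T = L1_of \<beta> **\<^sub>s L2_of \<beta> **\<^sub>s U_of \<beta>"
    using \<alpha> \<beta> by (auto simp: positive_bidiagonal_factorization_def)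
  note ea = iffD1[OF bidiagonal_factorization_iff[OF T za] Ta]
  note eb = iffD1[OF bidiagonal_factorization_iff[OF T zb] Tb]
  \<comment> \<open>Each step gains three indices: \<open>b (n + 1)\<close> determines
    \<open>\<alpha> (3n + 3)\<close>, then \<open>c (n + 1)\<close> determines
    \<open>\<alpha> (3n + 4)\<close>, then \<open>a (n + 2)\<close> determines
    \<open>\<alpha> (3n + 5)\<close>.\<close>
  have "\<forall>i\<le>3 * int n + 2. \<alpha> i = \<beta> i" for n
  proof (induction n)
    case 0
    have "\<alpha> 1 = \<beta> 1"
      using spec[OF conjunct1[OF ea], of 0] spec[OF conjunct1[OF eb], of 0] za zb by simp
    then have "\<alpha> i = \<beta> i" if "i \<le> 2" for i
      using that za zb x by (cases "i \<le> 0"; cases "i = 1"; cases "i = 2") auto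
    then show ?case by simp
  next
    case (Suc n)
    let ?k = "3 * int n"
    have old: "\<alpha> i = \<beta> i" if "i \<le> ?k + 2" for i using Suc that by blast
    \<comment> \<open>The coefficients to be cancelled avoid index 2, the only one without
      guaranteed positivity.\<close>
    have "?k + 1 \<noteq> 2" by presburger
    then have p: "\<alpha> (?k + 1) \<noteq> 0" "\<alpha> (?k + 3) \<noteq> 0"
      using pa[of "?k + 1"] pa[of "?k + 3"] by auto
    have "b (Suc n) = \<alpha> (?k + 3) * \<alpha> (?k + 1) + \<alpha> (?k + 2) * \<alpha> (?k + 1) + \<alpha> (?k + 2) * \<alpha> ?k"
      using ea[THEN conjunct2, THEN conjunct1, rule_format, of "Suc n"] by (simp add: algebra_simps)
    moreover have "b (Suc n) = \<beta> (?k + 3) * \<beta> (?k + 1) + \<beta> (?k + 2) * \<beta> (?k + 1) + \<beta> (?k + 2) * \<beta> ?k"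
      using eb[THEN conjunct2, THEN conjunct1, rule_format, of "Suc n"] by (simp add: algebra_simps)
    ultimately have 3: "\<alpha> (?k + 3) = \<beta> (?k + 3)"
      using old[of "?k + 1"] old[of "?k + 2"] old[of ?k] p by simp
    have "c (Suc n) = \<alpha> (?k + 4) + \<alpha> (?k + 3) + \<alpha> (?k + 2)"
      using ea[THEN conjunct1, rule_format, of "Suc n"] by (simp add: algebra_simps)
    moreover have "c (Suc n) = \<beta> (?k + 4) + \<beta> (?k + 3) + \<beta> (?k + 2)"
      using eb[THEN conjunct1, rule_format, of "Suc n"] by (simp add: algebra_simps)
    ultimately have 4: "\<alpha> (?k + 4) = \<beta> (?k + 4)"
      using old[of "?k + 2"] 3 by simp
    have "a (n + 2) = \<alpha> (?k + 5) * \<alpha> (?k + 3) * \<alpha> (?k + 1)"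
      using ea[THEN conjunct2, THEN conjunct2, rule_format, of "n + 2"] by (simp add: algebra_simps)
    moreover have "a (n + 2) = \<beta> (?k + 5) * \<beta> (?k + 3) * \<beta> (?k + 1)"
      using eb[THEN conjunct2, THEN conjunct2, rule_format, of "n + 2"] by (simp add: algebra_simps)
    ultimately have 5: "\<alpha> (?k + 5) = \<beta> (?k + 5)"
      using old[of "?k + 1"] 3 p by simp
    show ?case
    proof (intro allI impI)
      fix i assume "i \<le> 3 * int (Suc n) + 2"
      then consider "i \<le> ?k + 2" | "i = ?k + 3" | "i = ?k + 4" | "i = ?k + 5" by fastforce
      then show "\<alpha> i = \<beta> i" by cases (use old 3 4 5 in auto)
    qed
  qed
  moreover have "i \<le> 3 * int (nat i) + 2" for i by simp
  ultimately show ?thesis by blast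
qed

theorem theorem8:
  fixes T :: smat and c b a :: "nat \<Rightarrow> real" and x :: real
  assumes "tetradiagonal_Hessenberg T c b a"
    and "oscillatory T"
    and "x < K_inf T"
  shows "(\<exists>!\<alpha>. positive_bidiagonal_factorization T x \<alpha>) \<and>
    (\<forall>\<alpha>. positive_bidiagonal_factorization T x \<alpha> \<longrightarrow>
       (0 \<le> x \<longrightarrow> InTN (L1_of \<alpha>) \<and> InTN (L2_of \<alpha>) \<and> InTN (U_of \<alpha>)) \<and>
       (\<forall>n. c n = \<alpha> (3 * int n + 1) + \<alpha> (3 * int n) + \<alpha> (3 * int n - 1)) \<and>
       (\<forall>n\<ge>1. b n = \<alpha> (3 * int n) * \<alpha> (3 * int n - 2)
                     + \<alpha> (3 * int n - 1) * \<alpha> (3 * int n - 2)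
                     + \<alpha> (3 * int n - 1) * \<alpha> (3 * int n - 3)) \<and>
       (\<forall>n\<ge>2. a n = \<alpha> (3 * int n - 1) * \<alpha> (3 * int n - 3) * \<alpha> (3 * int n - 5)))"
proof (intro conjI allI impI)
  interpret regular_hessenberg T c b a
    using assms(1,2) oscillatory_mat_det_pos[OF leading_carrier]
    by unfold_locales (auto simp: oscillatory_def oscillatory_mat_def)
  show "\<exists>!\<alpha>. positive_bidiagonal_factorization T x \<alpha>"
    using factorization_exists[OF assms(3)] factorization_unique[OF assms(1)] by blast
  fix \<alpha> assume \<alpha>: "positive_bidiagonal_factorization T x \<alpha>"
  then have \<alpha>2: "\<alpha> 2 = x" and pos: "\<And>j. j \<ge> 1 \<Longrightarrow> j \<noteq> 2 \<Longrightarrow> 0 < \<alpha> j"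
    by (auto simp: positive_bidiagonal_factorization_def)
  have entries: "(\<forall>n. c n = \<alpha> (3 * int n + 1) + \<alpha> (3 * int n) + \<alpha> (3 * int n - 1)) \<and>
       (\<forall>n\<ge>1. b n = \<alpha> (3 * int n) * \<alpha> (3 * int n - 2)
                     + \<alpha> (3 * int n - 1) * \<alpha> (3 * int n - 2)
                     + \<alpha> (3 * int n - 1) * \<alpha> (3 * int n - 3)) \<and>
       (\<forall>n\<ge>2. a n = \<alpha> (3 * int n - 1) * \<alpha> (3 * int n - 3) * \<alpha> (3 * int n - 5))"
    using \<alpha> bidiagonal_factorization_iff[OF assms(1)]
    unfolding positive_bidiagonal_factorization_def by blast
  {
    assume "0 \<le> x"
    \<comment> \<open>Of the three factors only \<open>L\<^sub>1\<close> contains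
      \<open>\<alpha> 2\<close>, so the sign of \<open>x\<close> enters here.\<close>
    then have "0 \<le> \<alpha> j" if "1 \<le> j" for j
      using pos[of j] \<alpha>2 that by (cases "j = 2") auto
    then show "InTN (L1_of \<alpha>)"
      unfolding L1_of_def by (intro InTN_lower_unit_bidiag) simp
  next
    show "InTN (L2_of \<alpha>)"
      unfolding L2_of_def by (intro InTN_lower_unit_bidiag less_imp_le pos; presburger)
  next
    show "InTN (U_of \<alpha>)"
      unfolding U_of_def by (intro InTN_upper_bidiag pos; presburger)
  next
    fix n
    show "c n = \<alpha> (3 * int n + 1) + \<alpha> (3 * int n) + \<alpha> (3 * int n - 1)"
      using entries by blast
  next
    fix n :: nat assume "1 \<le> n"
    then show "b n = \<alpha> (3 * int n) * \<alpha> (3 * int n - 2) + \<alpha> (3 * int n - 1) * \<alpha> (3 * int n - 2)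
        + \<alpha> (3 * int n - 1) * \<alpha> (3 * int n - 3)"
      using entries by blast
  next
    fix n :: nat assume "2 \<le> n"
    then show "a n = \<alpha> (3 * int n - 1) * \<alpha> (3 * int n - 3) * \<alpha> (3 * int n - 5)"
      using entries by blast
  }
qed

end
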